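(* Let $n>3$ be an integer, let $a_0,a_1,T_1,\omega,f_0$ be real numbers with $a_1\neq0$ and $f_0\ne0$, and let $m_0>0$. On the set of $x\in\mathbb{R}$ with $a_0+a_1x>0$ put $$EI(x)=(a_0+a_1x)^n,\qquad m(x)=m_0(a_0+a_1x)^{\frac{f_0(n-4)+n\omega}{f_0}},\qquad T(x)=\frac{T_1(a_0+a_1x)^{n-2}}{a_1(n-2)}.$$ Let $R=\sqrt{a_1^3(n-2)(n-1)^2+4T_1}$ and suppose $a_1^{3/2}(n-3)\sqrt{n-2}+R\neq0$ and $a_1^{3/2}(n-3)\sqrt{n-2}-R\neq0$. For constants $A_1,A_2,A_3$ define $$G(x)=(a_0+a_1x)^{-n}\left(-\frac{2\sqrt{a_1}A_1\sqrt{n-2}\,(a_0+a_1x)^{\frac12\left(-\frac{R}{a_1^{3/2}\sqrt{n-2}}+n+3\right)}}{a_1^{3/2}(n-3)\sqrt{n-2}+R}-\frac{2\sqrt{a_1}A_2\sqrt{n-2}\,(a_0+a_1x)^{\frac12\left(\frac{R}{a_1^{3/2}\sqrt{n-2}}+n+3\right)}}{a_1^{3/2}(n-3)\sqrt{n-2}-R}-\frac{A_3(a_0+a_1x)^3}{a_1(n-3)}\right).$$ Then the function $u(x,t)=2t+G(x)$ satisfies, for all $x$ with $a_0+a_1x>0$ and all $t\in\mathbb{R}$, $$\frac{\partial^2}{\partial x^2}\left(EI(x)\frac{\partial^2u}{\partial x^2}\right)+m(x)\frac{\partial^2u}{\partial t^2}-\frac{\partial}{\partial x}\left(T(x)\frac{\partial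 u}{\partial x}\right)=0.$$
   Context: $EI(x)$ is a single function symbol (bending stiffness), $m(x)$ is the mass per unit length, and $T(x)$ is the axial load of an Euler–Bernoulli beam. The stiffness and mass functions are assumed positive. Square roots and the power $a_1^{3/2}=(\sqrt{a_1})^3$ are principal (complex) values, powers of the positive number $a_0+a_1x$ are defined by $s^z=e^{z\ln s}$, and $A_1,A_2,A_3$ (and hence $u$) may be complex. *)

theory Defs
  imports "HOL-Analysis.Analysis"
begin

definition dx :: "(real \<Rightarrow> real \<Rightarrow> complex) \<Rightarrow> real \<Rightarrow> real \<Rightarrow> complex" where
  "dx u x t = vector_derivative (\<lambda>y. u y t) (at x)"

definition dt :: "(real \<Rightarrow> real \<Rightarrow> complex) \<Rightarrow> real \<Rightarrow> real \<Rightarrow> complex" where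
  "dt u x t = vector_derivative (\<lambda>s. u x s) (at t)"

definition x_differentiable :: "(real \<Rightarrow> real \<Rightarrow> complex) \<Rightarrow> real \<Rightarrow> real \<Rightarrow> bool" where
  "x_differentiable u x t \<longleftrightarrow> (\<lambda>y. u y t) differentiable (at x)"

definition t_differentiable :: "(real \<Rightarrow> real \<Rightarrow> complex) \<Rightarrow> real \<Rightarrow> real \<Rightarrow> bool" where
  "t_differentiable u x t \<longleftrightarrow> (\<lambda>s. u x s) differentiable (at t)"

text \<open>Since \<open>vector_derivative\<close> is a total function, the existence of every derivative
  occurring in the equation is required explicitly.\<close>

definition beam_solution_on ::
  "real set \<Rightarrow> (real \<Rightarrow> real) \<Rightarrow> (real \<Rightarrow> real) \<Rightarrow> (real \<Rightarrow> real) \<Rightarrow> (real \<Rightarrow> real \<Rightarrow> complex) \<Rightarrow> bool"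
where
  "beam_solution_on S EI m T u \<longleftrightarrow>
    (let M = (\<lambda>x t. complex_of_real (EI x) * dx (dx u) x t);
         N = (\<lambda>x t. complex_of_real (T x) * dx u x t)
     in \<forall>x\<in>S. \<forall>t.
          x_differentiable u x t \<and> x_differentiable (dx u) x t \<and>
          x_differentiable M x t \<and> x_differentiable (dx M) x t \<and>
          x_differentiable N x t \<and>
          t_differentiable u x t \<and> t_differentiable (dt u) x t \<and>
          dx (dx M) x t + complex_of_real (m x) * dt (dt u) x t - dx N x t = 0)"

definition stiffness :: "int \<Rightarrow> real \<Rightarrow> real \<Rightarrow> real \<Rightarrow> real" where
  "stiffness n a0 a1 x = (a0 + a1 * x) powi n"

definition mass :: "int \<Rightarrow> real \<Rightarrow> real \<Rightarrow> real \<Rightarrow> real \<Rightarrow> real \<Rightarrow> real \<Rightarrow> real" where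
  "mass n a0 a1 m0 f0 \<omega> x =
     m0 * (a0 + a1 * x) powr ((f0 * (of_int n - 4) + of_int n * \<omega>) / f0)"

definition axial_load :: "int \<Rightarrow> real \<Rightarrow> real \<Rightarrow> real \<Rightarrow> real \<Rightarrow> real" where
  "axial_load n a0 a1 T1 x = T1 * (a0 + a1 * x) powi (n - 2) / (a1 * (of_int n - 2))"

text \<open>Neither \<open>a1\<close> nor the radicand of \<open>R\<close> need be positive, hence the complex square roots.\<close>

definition Rroot :: "int \<Rightarrow> real \<Rightarrow> real \<Rightarrow> complex" where
  "Rroot n a1 T1 = csqrt (of_real (a1 ^ 3 * (of_int n - 2) * (of_int n - 1)\<^sup>2 + 4 * T1))"

definition a1_three_halves :: "real \<Rightarrow> complex" where
  "a1_three_halves a1 = csqrt (of_real a1) ^ 3"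

text \<open>For \<open>s > 0\<close>, \<open>of_real s powr z\<close> is \<open>exp (z * of_real (ln s))\<close>.\<close>

definition Gfun ::
  "int \<Rightarrow> real \<Rightarrow> real \<Rightarrow> real \<Rightarrow> complex \<Rightarrow> complex \<Rightarrow> complex \<Rightarrow> real \<Rightarrow> complex"
where
  "Gfun n a0 a1 T1 A1 A2 A3 x =
    (let s = complex_of_real (a0 + a1 * x);
         R = Rroot n a1 T1;
         c = a1_three_halves a1;
         q = csqrt (of_int n - 2)
     in s powi (- n) *
        (- (2 * csqrt (of_real a1) * A1 * q * s powr (1 / 2 * (- (R / (c * q)) + of_int n + 3)))
             / (c * (of_int n - 3) * q + R)
         - (2 * csqrt (of_real a1) * A2 * q * s powr (1 / 2 * (R / (c * q) + of_int n + 3)))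
             / (c * (of_int n - 3) * q - R)
         - A3 * s ^ 3 / (of_real a1 * (of_int n - 3))))"

end

theory Submission
  imports Defs
begin

text \<open>
  Write \<open>s = a0 + a1 x\<close>. The beam operator is homogeneous in \<open>s\<close>: since the stiffness is
  \<open>s\<^sup>n\<close> and the axial load is a multiple of \<open>s\<close> to the power \<open>n - 2\<close>, both spatial terms send
  \<open>s powr p\<close> to a multiple of \<open>s powr (p + n - 4)\<close>. Their difference carries the factor
  \<open>a1 / (n - 2) * p (p + n - 3) (a1\<^sup>3 (n - 2) (p - 1) (p + n - 2) - T1)\<close>, so the spatial problem
  is an Euler equation with this indicial polynomial.

  The function \<open>G\<close> is a linear combination of three powers of \<open>s\<close>. One exponent is \<open>3 - n\<close>,
  which annihilates \<open>p + n - 3\<close>. The other two are \<open>(3 - n \<plusminus> r) / 2\<close> with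
  \<open>r = R / (c q)\<close>, \<open>c = csqrt a1 ^ 3\<close> and \<open>q = csqrt (n - 2)\<close>; there
  \<open>(p - 1) (p + n - 2) = (r\<^sup>2 - (n - 1)\<^sup>2) / 4\<close>, and squaring removes all the square roots, giving
  \<open>r\<^sup>2 = (n - 1)\<^sup>2 + 4 T1 / (a1\<^sup>3 (n - 2))\<close>, which annihilates the last factor. The summand
  \<open>2 t\<close> disappears under the \<open>x\<close>-derivative and under the second \<open>t\<close>-derivative, so no
  inertia term remains. The Euler equation is solved for arbitrary finite combinations of powers in
  \<open>beam_solution_on_sum_powr\<close>, the exponents are treated in \<open>indicial_root\<close>, and
  \<open>Gfun_eq_sum_powr\<close> supplies the decomposition of \<open>G\<close>.
\<close>

lemma has_vector_derivative_affine_powr: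
  fixes a0 a1 x :: real and p :: complex
  assumes "a0 + a1 * x > 0"
  shows "((\<lambda>y. complex_of_real (a0 + a1 * y) powr p) has_vector_derivative
          of_real a1 * p * complex_of_real (a0 + a1 * x) powr (p - 1)) (at x)"
proof -
  have nonpos: "complex_of_real (a0 + a1 * x) \<notin> \<real>\<^sub>\<le>\<^sub>0"
    using assms complex_nonpos_Reals_iff by force
  have outer: "((\<lambda>z. z powr p) has_field_derivative p * complex_of_real (a0 + a1 * x) powr (p - 1))
      (at (complex_of_real (a0 + a1 * x)))"
    using nonpos by (rule has_field_derivative_powr)
  have "((\<lambda>y. complex_of_real (a0 + a1 * y)) has_vector_derivative of_real a1) (at x)"
    by (rule has_vector_derivative_of_real)
       (auto intro!: derivative_eq_intros simp: has_real_derivative_iff_has_vector_derivative[symmetric])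
  from field_vector_diff_chain_at[OF this outer] show ?thesis
    by (simp add: o_def mult.assoc)
qed

text \<open>Agreement with the sum on the half-line suffices because the half-line is open. This
  lets the lemma be applied again to the derivative, whose formula is known only there.\<close>

lemma dx_sum_powr:
  fixes a0 a1 x :: real and b p :: "'i \<Rightarrow> complex"
  assumes u: "\<And>y. a0 + a1 * y > 0 \<Longrightarrow>
      u y t = c + (\<Sum>i\<in>I. b i * complex_of_real (a0 + a1 * y) powr p i)"
    and x: "a0 + a1 * x > 0"
  shows "x_differentiable u x t"
    and "dx u x t = (\<Sum>i\<in>I. (of_real a1 * p i * b i) * complex_of_real (a0 + a1 * x) powr (p i - 1))"
proof -
  let ?D = "\<Sum>i\<in>I. (of_real a1 * p i * b i) * complex_of_real (a0 + a1 * x) powr (p i - 1)"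
  have "((\<lambda>y. c + (\<Sum>i\<in>I. b i * complex_of_real (a0 + a1 * y) powr p i)) has_vector_derivative
      0 + (\<Sum>i\<in>I. b i * (of_real a1 * p i * complex_of_real (a0 + a1 * x) powr (p i - 1)))) (at x)"
    by (intro has_vector_derivative_add has_vector_derivative_const has_vector_derivative_sum
        has_vector_derivative_mult_right has_vector_derivative_affine_powr x)
  then have "((\<lambda>y. c + (\<Sum>i\<in>I. b i * complex_of_real (a0 + a1 * y) powr p i))
      has_vector_derivative ?D) (at x)"
    by (simp add: mult_ac)
  moreover have "open {y. a0 + a1 * y > 0}"
    by (intro open_Collect_less continuous_intros)
  ultimately have "((\<lambda>y. u y t) has_vector_derivative ?D) (at x)"
    by (rule has_vector_derivative_transform_within_open) (use x u in auto)
  then show "x_differentiable u x t" "dx u x t = ?D"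
    unfolding x_differentiable_def dx_def
    by (auto intro: differentiableI_vector vector_derivative_at)
qed

text \<open>The hypothesis on the exponents is the indicial equation of the Euler operator. By
  linearity it suffices that each exponent satisfies it.\<close>

lemma beam_solution_on_sum_powr:
  fixes n :: int and a0 a1 T1 :: real and \<alpha> :: complex and b p :: "'i \<Rightarrow> complex"
  assumes "n \<noteq> 2" and "a1 \<noteq> 0"
    and u: "\<And>x t. a0 + a1 * x > 0 \<Longrightarrow>
      u x t = \<alpha> * of_real t + (\<Sum>i\<in>I. b i * complex_of_real (a0 + a1 * x) powr p i)"
    and indicial: "\<And>i. i \<in> I \<Longrightarrow> p i * (p i + of_int n - 3) *
      (of_real a1 ^ 3 * (of_int n - 2) * (p i - 1) * (p i + of_int n - 2) - of_real T1) = 0"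
  shows "beam_solution_on {x. a0 + a1 * x > 0}
           (stiffness n a0 a1) m (axial_load n a0 a1 T1) u"
proof -
  define M where "M = (\<lambda>x t. complex_of_real (stiffness n a0 a1 x) * dx (dx u) x t)"
  define N where "N = (\<lambda>x t. complex_of_real (axial_load n a0 a1 T1 x) * dx u x t)"
  define P where "P = (\<lambda>x z. complex_of_real (a0 + a1 * x) powr z)"
  define k where "k = complex_of_real T1 / (of_real a1 * (of_int n - 2))"
  have powi_P: "complex_of_real (a0 + a1 * x) powi j * P x z = P x (z + of_int j)"
    if "a0 + a1 * x > 0" for x z and j :: int
  proof -
    have "complex_of_real (a0 + a1 * x) \<noteq> 0"
      using that by (simp del: of_real_add of_real_mult)
    then show ?thesis
      unfolding P_def by (simp add: powr_add complex_powr_of_int mult.commute)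
  qed
  have u1: "x_differentiable u x t"
    and dxu: "dx u x t = (\<Sum>i\<in>I. (of_real a1 * p i * b i) * P x (p i - 1))"
    if "a0 + a1 * x > 0" for x t
    using dx_sum_powr[OF u that] unfolding P_def by auto
  have dxu': "dx u x t = 0 + (\<Sum>i\<in>I. (of_real a1 * p i * b i) * P x (p i - 1))"
    if "a0 + a1 * x > 0" for x t
    using dxu[OF that] by simp
  have u2: "x_differentiable (dx u) x t"
    and dxxu: "dx (dx u) x t = (\<Sum>i\<in>I. (of_real a1 * (p i - 1) * (of_real a1 * p i * b i)) * P x (p i - 1 - 1))"
    if "a0 + a1 * x > 0" for x t
    using dx_sum_powr[OF dxu'[unfolded P_def] that] unfolding P_def by auto
  have M: "M x t = 0 + (\<Sum>i\<in>I. (of_real a1 * (p i - 1) * (of_real a1 * p i * b i)) * P x (p i + of_int n - 2))"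
    if "a0 + a1 * x > 0" for x t
  proof -
    have "M x t = (\<Sum>i\<in>I. (of_real a1 * (p i - 1) * (of_real a1 * p i * b i)) *
        (complex_of_real (a0 + a1 * x) powi n * P x (p i - 1 - 1)))"
      unfolding M_def stiffness_def dxxu[OF that] sum_distrib_left by (simp add: mult_ac)
    then show ?thesis
      unfolding powi_P[OF that] by (simp add: algebra_simps)
  qed
  have M1: "x_differentiable M x t"
    and dxM: "dx M x t = (\<Sum>i\<in>I. (of_real a1 * (p i + of_int n - 2) *
      (of_real a1 * (p i - 1) * (of_real a1 * p i * b i))) * P x (p i + of_int n - 2 - 1))"
    if "a0 + a1 * x > 0" for x t
    using dx_sum_powr[OF M[unfolded P_def] that] unfolding P_def by auto
  have dxM': "dx M x t = 0 + (\<Sum>i\<in>I. (of_real a1 * (p i + of_int n - 2) *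
      (of_real a1 * (p i - 1) * (of_real a1 * p i * b i))) * P x (p i + of_int n - 3))"
    if "a0 + a1 * x > 0" for x t
    using dxM[OF that] by (simp add: diff_diff_eq)
  have M2: "x_differentiable (dx M) x t"
    and dxxM: "dx (dx M) x t = (\<Sum>i\<in>I. (of_real a1 * (p i + of_int n - 3) * (of_real a1 * (p i + of_int n - 2) *
      (of_real a1 * (p i - 1) * (of_real a1 * p i * b i)))) * P x (p i + of_int n - 3 - 1))"
    if "a0 + a1 * x > 0" for x t
    using dx_sum_powr[OF dxM'[unfolded P_def] that] unfolding P_def by auto
  have N: "N x t = 0 + (\<Sum>i\<in>I. (k * (of_real a1 * p i * b i)) * P x (p i + of_int n - 3))"
    if "a0 + a1 * x > 0" for x t
  proof -
    have T: "complex_of_real (axial_load n a0 a1 T1 x) =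
        k * complex_of_real (a0 + a1 * x) powi (n - 2)"
      unfolding axial_load_def k_def by simp
    have "N x t = (\<Sum>i\<in>I. (k * (of_real a1 * p i * b i)) *
        (complex_of_real (a0 + a1 * x) powi (n - 2) * P x (p i - 1)))"
      unfolding N_def T dxu[OF that] sum_distrib_left by (simp add: mult_ac)
    then show ?thesis
      unfolding powi_P[OF that] by (simp add: algebra_simps)
  qed
  have N1: "x_differentiable N x t"
    and dxN: "dx N x t = (\<Sum>i\<in>I. (of_real a1 * (p i + of_int n - 3) *
      (k * (of_real a1 * p i * b i))) * P x (p i + of_int n - 3 - 1))"
    if "a0 + a1 * x > 0" for x t
    using dx_sum_powr[OF N[unfolded P_def] that] unfolding P_def by auto
  have u_t: "((\<lambda>s. u x s) has_vector_derivative \<alpha>) (at t)" if "a0 + a1 * x > 0" for x t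
    unfolding u[OF that] by (auto intro!: derivative_eq_intros)
  then have dtu: "dt u x t = \<alpha>" if "a0 + a1 * x > 0" for x t
    using that unfolding dt_def by (auto intro: vector_derivative_at)
  have t1: "t_differentiable u x t" if "a0 + a1 * x > 0" for x t
    using u_t[OF that] unfolding t_differentiable_def by (auto intro: differentiableI_vector)
  have t2: "t_differentiable (dt u) x t" "dt (dt u) x t = 0" if "a0 + a1 * x > 0" for x t
  proof -
    have "dt u x = (\<lambda>_. \<alpha>)"
      using dtu[OF that] by blast
    then show "t_differentiable (dt u) x t" "dt (dt u) x t = 0"
      unfolding t_differentiable_def dt_def[of "dt u"] by simp_all
  qed
  have "dx (dx M) x t - dx N x t = 0" if x: "a0 + a1 * x > 0" for x t
  proof -
    have n2: "(of_int n :: complex) - 2 \<noteq> 0"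
      using \<open>n \<noteq> 2\<close> by (metis eq_iff_diff_eq_0 of_int_eq_numeral_iff)
    have "of_real a1 * (p i + of_int n - 3) * (of_real a1 * (p i + of_int n - 2) *
        (of_real a1 * (p i - 1) * (of_real a1 * p i * b i)))
      = of_real a1 * (p i + of_int n - 3) * (k * (of_real a1 * p i * b i))" if "i \<in> I" for i
    proof -
      have "p i * (p i + of_int n - 3) * (of_real T1) =
        p i * (p i + of_int n - 3) *
          (of_real a1 ^ 3 * (of_int n - 2) * (p i - 1) * (p i + of_int n - 2))"
        using indicial[OF that] by (simp add: right_diff_distrib)
      moreover have "of_real T1 = k * (of_real a1 * (of_int n - 2))"
        unfolding k_def using n2 \<open>a1 \<noteq> 0\<close> by simp
      ultimately have "(of_int n - 2) * (of_real a1 * (p i * (p i + of_int n - 3) * k)) = (of_int n - 2) *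
        (of_real a1 * (p i * (p i + of_int n - 3) * (of_real a1 ^ 2 * (p i - 1) * (p i + of_int n - 2))))"
        by (simp add: power2_eq_square power3_eq_cube mult_ac)
      then have "p i * (p i + of_int n - 3) * k =
          p i * (p i + of_int n - 3) * (of_real a1 ^ 2 * (p i - 1) * (p i + of_int n - 2))"
        using n2 \<open>a1 \<noteq> 0\<close> by (simp only: mult_cancel_left of_real_eq_0_iff simp_thms)
      from arg_cong[OF this[symmetric], of "\<lambda>z. of_real a1 ^ 2 * b i * z"] show ?thesis
        by (simp add: power2_eq_square mult_ac)
    qed
    then show ?thesis
      unfolding dxxM[OF x] dxN[OF x] right_minus_eq
      by (intro sum.cong[OF refl]) (simp only:)
  qed
  with u1 u2 M1 M2 N1 t1 t2 show ?thesis
    unfolding beam_solution_on_def Let_def M_def[symmetric] N_def[symmetric] by simp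
qed

text \<open>Only \<open>r\<^sup>2\<close> enters, so both signs of \<open>r\<close> and every choice of the square roots are covered.\<close>

lemma indicial_root:
  fixes \<nu> a T p r :: complex
  assumes "a ^ 3 * (\<nu> - 2) * r\<^sup>2 = a ^ 3 * (\<nu> - 2) * (\<nu> - 1)\<^sup>2 + 4 * T"
    and "2 * p = 3 - \<nu> + r"
  shows "a ^ 3 * (\<nu> - 2) * (p - 1) * (p + \<nu> - 2) - T = 0"
proof -
  have p: "p = (3 - \<nu> + r) / 2"
    using assms(2) by (simp add: field_simps)
  have "4 * ((p - 1) * (p + \<nu> - 2)) = r\<^sup>2 - (\<nu> - 1)\<^sup>2"
    unfolding p by (simp add: field_simps power2_eq_square)
  then have "a ^ 3 * (\<nu> - 2) * (4 * ((p - 1) * (p + \<nu> - 2))) = 4 * T"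
    using assms(1) by (simp add: right_diff_distrib)
  then have "4 * (a ^ 3 * (\<nu> - 2) * (p - 1) * (p + \<nu> - 2)) = 4 * T"
    by (simp only: mult_ac)
  then show ?thesis
    by simp
qed

lemma Rroot_ratio_squared:
  fixes n :: int
  assumes "n \<noteq> 2" and "a1 \<noteq> 0"
  shows "of_real a1 ^ 3 * (of_int n - 2) * (Rroot n a1 T1 / (a1_three_halves a1 * csqrt (of_int n - 2)))\<^sup>2
    = of_real a1 ^ 3 * (of_int n - 2) * (of_int n - 1)\<^sup>2 + 4 * of_real T1"
proof -
  have n2: "(of_int n :: complex) - 2 \<noteq> 0"
    using assms(1) by (metis eq_iff_diff_eq_0 of_int_eq_numeral_iff)
  have "(a1_three_halves a1)\<^sup>2 = ((csqrt (of_real a1))\<^sup>2) ^ 3"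
    unfolding a1_three_halves_def by (simp only: power_mult[symmetric] mult.commute)
  then have c: "(a1_three_halves a1)\<^sup>2 = of_real a1 ^ 3"
    by simp
  have R: "(Rroot n a1 T1)\<^sup>2 = of_real a1 ^ 3 * (of_int n - 2) * (of_int n - 1)\<^sup>2 + 4 * of_real T1"
    unfolding Rroot_def by simp
  show ?thesis
    unfolding power_divide power_mult_distrib c R power2_csqrt using n2 assms(2) by simp
qed

lemma Gfun_eq_sum_powr:
  fixes n :: int and a0 a1 T1 x :: real and A1 A2 A3 :: complex
  defines "R \<equiv> Rroot n a1 T1" and "c \<equiv> a1_three_halves a1" and "q \<equiv> csqrt (of_int n - 2)"
  defines "r \<equiv> R / (c * q)"
  assumes "a0 + a1 * x > 0"
  shows "Gfun n a0 a1 T1 A1 A2 A3 x =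
    (\<Sum>i<3. [- (2 * csqrt (of_real a1) * A1 * q) / (c * (of_int n - 3) * q + R),
             - (2 * csqrt (of_real a1) * A2 * q) / (c * (of_int n - 3) * q - R),
             - A3 / (of_real a1 * (of_int n - 3))] ! i *
       complex_of_real (a0 + a1 * x) powr
         ([(3 - of_int n - r) / 2, (3 - of_int n + r) / 2, 3 - of_int n] ! i))"
proof -
  define s where "s = complex_of_real (a0 + a1 * x)"
  have s0: "s \<noteq> 0"
    using assms unfolding s_def by (simp del: of_real_add of_real_mult)
  have powi_s: "s powi (- n) = s powr (- of_int n)"
    using s0 complex_powr_of_int[of s "- n"] by simp
  have s3: "s ^ 3 = s powr 3"
    using s0 by simp
  have e1: "s powi (- n) * s powr (1 / 2 * (- r + of_int n + 3)) = s powr ((3 - of_int n - r) / 2)"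
    unfolding powi_s powr_add[symmetric] by (simp add: field_simps)
  have e2: "s powi (- n) * s powr (1 / 2 * (r + of_int n + 3)) = s powr ((3 - of_int n + r) / 2)"
    unfolding powi_s powr_add[symmetric] by (simp add: field_simps)
  have e3: "s powi (- n) * s ^ 3 = s powr (3 - of_int n)"
    unfolding powi_s s3 powr_add[symmetric] by simp
  have "Gfun n a0 a1 T1 A1 A2 A3 x =
      - (2 * csqrt (of_real a1) * A1 * q) / (c * (of_int n - 3) * q + R) *
        (s powi (- n) * s powr (1 / 2 * (- r + of_int n + 3)))
    + - (2 * csqrt (of_real a1) * A2 * q) / (c * (of_int n - 3) * q - R) *
        (s powi (- n) * s powr (1 / 2 * (r + of_int n + 3)))
    + - A3 / (of_real a1 * (of_int n - 3)) * (s powi (- n) * s ^ 3)"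
    unfolding Gfun_def Let_def s_def[symmetric] r_def R_def c_def q_def
    by (simp add: right_diff_distrib mult_ac)
  then show ?thesis
    unfolding e1 e2 e3 s_def[symmetric] by (simp add: eval_nat_numeral)
qed

theorem mainTheorem3:
  fixes n :: int and a0 a1 T1 \<omega> f0 m0 :: real and A1 A2 A3 :: complex
  assumes "n > 3" and "a1 \<noteq> 0" and "f0 \<noteq> 0" and "m0 > 0"
    and "a1_three_halves a1 * (of_int n - 3) * csqrt (of_int n - 2) + Rroot n a1 T1 \<noteq> 0"
    and "a1_three_halves a1 * (of_int n - 3) * csqrt (of_int n - 2) - Rroot n a1 T1 \<noteq> 0"
  shows "beam_solution_on {x. a0 + a1 * x > 0}
           (stiffness n a0 a1) (mass n a0 a1 m0 f0 \<omega>) (axial_load n a0 a1 T1)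
           (\<lambda>x t. 2 * of_real t + Gfun n a0 a1 T1 A1 A2 A3 x)"
proof -
  define r where "r = Rroot n a1 T1 / (a1_three_halves a1 * csqrt (of_int n - 2))"
  define p where "p = (!) [(3 - of_int n - r) / 2, (3 - of_int n + r) / 2, 3 - of_int n]"
  have n: "n \<noteq> 2"
    using assms(1) by simp
  have r2: "of_real a1 ^ 3 * (of_int n - 2) * r\<^sup>2
      = of_real a1 ^ 3 * (of_int n - 2) * (of_int n - 1)\<^sup>2 + 4 * of_real T1"
    unfolding r_def using n assms(2) by (rule Rroot_ratio_squared)
  have "p i * (p i + of_int n - 3) *
      (of_real a1 ^ 3 * (of_int n - 2) * (p i - 1) * (p i + of_int n - 2) - of_real T1) = 0"
    if "i \<in> {..<3}" for i
  proof -
    from that consider "i = 0" | "i = 1" | "i = 2"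
      by force
    then show ?thesis
    proof cases
      case 1
      then have "2 * p i = 3 - of_int n + - r"
        unfolding p_def by simp
      with r2 have "of_real a1 ^ 3 * (of_int n - 2) * (p i - 1) * (p i + of_int n - 2) - of_real T1 = 0"
        by (intro indicial_root[where r = "- r"]) simp_all
      then show ?thesis
        by (simp only: mult_zero_right)
    next
      case 2
      then have "2 * p i = 3 - of_int n + r"
        unfolding p_def by simp
      with r2 have "of_real a1 ^ 3 * (of_int n - 2) * (p i - 1) * (p i + of_int n - 2) - of_real T1 = 0"
        by (rule indicial_root)
      then show ?thesis
        by (simp only: mult_zero_right)
    next
      case 3
      then show ?thesis
        unfolding p_def by simp
    qed
  qed
  then show ?thesis
    by (intro beam_solution_on_sum_powr[OF n assms(2)])
       (simp_all only: p_def r_def Gfun_eq_sum_powr)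
qed

end
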